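(* Let $X=[\ell,u]\subseteq\mathbb{R}^n$ be a box with $\ell_i<u_i$ for all $i$, let $g:\mathbb{R}^n\to\mathbb{R}$ and $h:\mathbb{R}^n\to\mathbb{R}$ be convex functions, and let $\epsilon>0$. When Algorithm 3 (defined in the context) stops, it returns an $\epsilon$-solution of the problem $\min_{x\in X}(g(x)-h(x))$; that is, the returned point $x^k\in X$ satisfies $g(x^k)-h(x^k)\le\min_{x\in X}(g(x)-h(x))+\epsilon$.
   Context: $X=\{x\in\mathbb{R}^n\mid \ell_i\le x_i\le u_i,\ i=1,\dots,n\}$ with $\ell_i<u_i$ for all $i$. For $x\in\mathbb{R}^n$, $c(x)$ denotes an (arbitrary, chosen) element of the subdifferential $\partial g(x)$, and for $x^*\in\mathbb{R}^n$, $$H(g,x^* )=\{(x,t)\in\mathbb{R}^n\times\mathbb{R}\mid t-c(x^* )^{\mathsf T}x\ge g(x^* )-c(x^* )^{\mathsf T}x^*\}.$$ $\operatorname{vert} C$ denotes the set of vertices of a polyhedral convex set $C$. Algorithm 3 (input $g,h$, $X=[\ell,u]$, $\epsilon$): Set $k=0$, $x^0=\frac{\ell+u}{2}$, $\bar C^0=H(g,x^0)\cap(X\times\mathbb{R})$, $g^0(x)=g(x^0)+c(x^0)^{\mathsf T}(x-x^0)$. Repeat: increase $k$ by $1$; compute $\operatorname{vert}\bar C^{k-1}$ and choose $(x^k,y^k)\in\arg\min_{(x,y)\in\operatorname{vert}\bar C^{k-1}}(y-h(x))$. If $g(x^k)-y^k>\epsilon$, set $s^k(x)=g(x^k)+c(x^k)^{\mathsf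 T}(x-x^k)$, $g^k(x)=\max\{g^{k-1}(x),s^k(x)\}$, $\bar C^k=\bar C^{k-1}\cap H(g,x^k)$; otherwise stop and return $x^k$. *)

theory Defs
  imports "HOL-Analysis.Analysis"
begin

definition subdifferential :: "('a::real_inner \<Rightarrow> real) \<Rightarrow> 'a \<Rightarrow> 'a set" where
  "subdifferential g x = {s. \<forall>y. g y \<ge> g x + s \<bullet> (y - x)}"

text \<open>The half-space \<open>H(g,z)\<close> depends on the selected subgradients \<open>c\<close>, which the usual
  notation leaves implicit.\<close>

definition cut_halfspace ::
  "('a::real_inner \<Rightarrow> real) \<Rightarrow> ('a \<Rightarrow> 'a) \<Rightarrow> 'a \<Rightarrow> ('a \<times> real) set" where
  "cut_halfspace g c z = {(x, t). t - c z \<bullet> x \<ge> g z - c z \<bullet> z}"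

definition vert :: "'a::real_vector set \<Rightarrow> 'a set" where
  "vert C = {v. v extreme_point_of C}"

definition argmin_vert :: "('a::real_vector \<Rightarrow> real) \<Rightarrow> ('a \<times> real) set \<Rightarrow> ('a \<times> real) set" where
  "argmin_vert h C = {p. is_arg_min (\<lambda>(x, y). y - h x) (\<lambda>q. q \<in> vert C) p}"

text \<open>\<open>alg3_state g h c l u \<epsilon> k x G C\<close>: some execution of the algorithm completes iteration \<open>k\<close>
  without stopping (\<open>k = 0\<close> being the initialisation), with current point \<open>x = x\<^sup>k\<close>, minorant
  \<open>G = g\<^sup>k\<close> and polyhedron \<open>C\<close>, the k-th outer approximation. It is a relation because the choice
  of a minimising vertex is not determined; the subgradient selection \<open>c\<close> is fixed.\<close>

inductive alg3_state ::
  "(real^'n \<Rightarrow> real) \<Rightarrow> (real^'n \<Rightarrow> real) \<Rightarrow> (real^'n \<Rightarrow> real^'n) \<Rightarrow> real^'n \<Rightarrow> real^'n \<Rightarrow> real \<Rightarrow>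
   nat \<Rightarrow> real^'n \<Rightarrow> (real^'n \<Rightarrow> real) \<Rightarrow> ((real^'n) \<times> real) set \<Rightarrow> bool"
  for g h c l u \<epsilon> where
  init: "x0 = (1/2) *\<^sub>R (l + u) \<Longrightarrow>
    alg3_state g h c l u \<epsilon> 0 x0 (\<lambda>x. g x0 + c x0 \<bullet> (x - x0))
      (cut_halfspace g c x0 \<inter> (cbox l u \<times> UNIV))"
| iterate: "alg3_state g h c l u \<epsilon> k x G C \<Longrightarrow>
    (x', y') \<in> argmin_vert h C \<Longrightarrow> g x' - y' > \<epsilon> \<Longrightarrow>
    alg3_state g h c l u \<epsilon> (Suc k) x' (\<lambda>z. max (G z) (g x' + c x' \<bullet> (z - x')))
      (C \<inter> cut_halfspace g c x')"

text \<open>Some execution of the algorithm stops in iteration \<open>k\<close> and returns \<open>x\<close>.\<close>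

definition alg3_returns ::
  "(real^'n \<Rightarrow> real) \<Rightarrow> (real^'n \<Rightarrow> real) \<Rightarrow> (real^'n \<Rightarrow> real^'n) \<Rightarrow> real^'n \<Rightarrow> real^'n \<Rightarrow> real \<Rightarrow>
   nat \<Rightarrow> real^'n \<Rightarrow> bool" where
  "alg3_returns g h c l u \<epsilon> k x \<longleftrightarrow>
    (\<exists>j x' G C y. k = Suc j \<and> alg3_state g h c l u \<epsilon> j x' G C \<and>
       (x, y) \<in> argmin_vert h C \<and> \<not> g x - y > \<epsilon>)"

text \<open>That the minimum of \<open>f\<close> over \<open>X\<close> is attained is part of this definition.\<close>

definition eps_solution :: "('a \<Rightarrow> real) \<Rightarrow> 'a set \<Rightarrow> real \<Rightarrow> 'a \<Rightarrow> bool" where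
  "eps_solution f X \<epsilon> x \<longleftrightarrow>
    x \<in> X \<and> (\<exists>z. is_arg_min f (\<lambda>y. y \<in> X) z \<and> f x \<le> f z + \<epsilon>)"

end

theory Submission
  imports Defs
begin

text \<open>
  Throughout the run the outer approximation \<open>C\<close> contains the epigraph of \<open>g\<close> over the box,
  because every cut is a subgradient inequality. The algorithm, however, minimises
  \<open>y - h z\<close> only over the vertices \<open>(z, y)\<close> of \<open>C\<close>, so the heart of the proof is that this
  vertex minimum is a lower bound for \<open>g - h\<close> on the box: every \<open>z\<close> in the box admits a vertex
  whose objective value is at most \<open>g z - h z\<close> (\<open>vertex_below_epigraph_point\<close>). With this, if
  the algorithm stops at the vertex \<open>(x, y)\<close>, then
  \<open>g x - h x \<le> (y - h x) + \<epsilon> \<le> (g z - h z) + \<epsilon>\<close> for all \<open>z\<close> in the box.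

  The objective \<open>y - h z\<close> is concave, and a concave function on a compact convex set is minimised
  at an extreme point. The set \<open>C\<close> is unbounded, so it is truncated at a height \<open>T\<close> above
  all values of \<open>g\<close> on the box. A minimising extreme point \<open>e\<close> of the truncation lies strictly
  below height \<open>T\<close>: otherwise the epigraph point with the same first component would have a smaller
  objective value. Since extremality in a convex set is a local property
  (\<open>extreme_point_of_localize\<close>), \<open>e\<close> is then an extreme point of \<open>C\<close> itself, i.e. a vertex.
  The compactness of the truncation rests on the first cut, which bounds \<open>C\<close> from below over the box.
\<close>

section \<open>Extreme points and concave minimisation\<close>

text \<open>A segment in \<open>S\<close> with \<open>e\<close> in its interior can be shrunk towards \<open>e\<close>, keeping the ratio in which
  \<open>e\<close> divides it, until it lies inside any given neighbourhood of \<open>e\<close>.\<close>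

lemma extreme_point_of_localize:
  fixes e :: "'a::real_normed_vector"
  assumes "convex S" and "open U" and "e \<in> U" and "U \<subseteq> V"
    and ext: "e extreme_point_of (S \<inter> V)"
  shows "e extreme_point_of S"
proof -
  have eS: "e \<in> S"
    using ext by (simp add: extreme_point_of_def)
  moreover have "e \<notin> open_segment a b" if "a \<in> S" "b \<in> S" for a b
  proof
    assume "e \<in> open_segment a b"
    then obtain s where "a \<noteq> b" and s: "0 < s" "s < 1" "e = (1 - s) *\<^sub>R a + s *\<^sub>R b"
      by (auto simp: in_segment)
    have shrink: "\<forall>\<^sub>F r in at_right (0::real). e + r *\<^sub>R (d - e) \<in> U" for d
    proof (rule topological_tendstoD)
      have "((\<lambda>r. e + r *\<^sub>R (d - e)) \<longlongrightarrow> e + 0 *\<^sub>R (d - e)) (at_right 0)"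
        by (intro tendsto_intros)
      then show "((\<lambda>r. e + r *\<^sub>R (d - e)) \<longlongrightarrow> e) (at_right 0)"
        by simp
    qed (use assms in auto)
    have "\<forall>\<^sub>F r in at_right (0::real). r \<in> {0<..<1}"
      by (rule eventually_at_right_real) simp
    with shrink[of a] shrink[of b]
    have "\<forall>\<^sub>F r in at_right (0::real).
        r \<in> {0<..<1} \<and> e + r *\<^sub>R (a - e) \<in> U \<and> e + r *\<^sub>R (b - e) \<in> U"
      by eventually_elim simp
    then obtain r :: real where r: "0 < r" "r < 1"
      and U: "e + r *\<^sub>R (a - e) \<in> U" "e + r *\<^sub>R (b - e) \<in> U"
      using eventually_happens[of _ "at_right (0::real)"] by auto
    define a' b' where "a' = e + r *\<^sub>R (a - e)" and "b' = e + r *\<^sub>R (b - e)"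
    have inS: "e + r *\<^sub>R (d - e) \<in> S" if "d \<in> S" for d
      using convexD[OF \<open>convex S\<close> eS that, of "1 - r" r] r by (simp add: algebra_simps)
    have "a' \<in> S \<inter> V" "b' \<in> S \<inter> V"
      using that U \<open>U \<subseteq> V\<close> by (auto simp: a'_def b'_def intro: inS)
    moreover have "e \<in> open_segment a' b'"
    proof -
      have "(1 - s) *\<^sub>R a' + s *\<^sub>R b' = e + r *\<^sub>R (((1 - s) *\<^sub>R a + s *\<^sub>R b) - e)"
        by (simp add: a'_def b'_def algebra_simps)
      also have "\<dots> = e"
        using s(3) by simp
      finally show ?thesis
        using s \<open>a \<noteq> b\<close> r by (auto simp: in_segment a'_def b'_def)
    qed
    ultimately show False
      using ext by (auto simp: extreme_point_of_def)
  qed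
  ultimately show ?thesis
    by (simp add: extreme_point_of_def)
qed

text \<open>Otherwise the generators would all lie in the strict sublevel set of \<open>f\<close> at level \<open>f p\<close>, and so
  would their convex hull, because that sublevel set is convex.\<close>

lemma convex_on_convex_hull_le_generator:
  fixes f :: "'a::real_vector \<Rightarrow> real"
  assumes "convex_on UNIV f" and "p \<in> convex hull E"
  shows "\<exists>e\<in>E. f p \<le> f e"
proof (rule ccontr)
  assume "\<not> ?thesis"
  then have "E \<subseteq> {q. f q < f p}"
    by force
  moreover have "convex {q. f q < f p}"
  proof (rule convexI)
    fix a b and s t :: real
    assume *: "a \<in> {q. f q < f p}" "b \<in> {q. f q < f p}" "0 \<le> s" "0 \<le> t" "s + t = 1"
    then have "f (s *\<^sub>R a + t *\<^sub>R b) \<le> s * f a + t * f b"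
      using \<open>convex_on UNIV f\<close> by (simp add: convex_on_def)
    also have "\<dots> < f p"
      using * by (intro convex_bound_lt) auto
    finally show "s *\<^sub>R a + t *\<^sub>R b \<in> {q. f q < f p}"
      by simp
  qed
  ultimately have "convex hull E \<subseteq> {q. f q < f p}"
    by (rule hull_minimal)
  with assms(2) show False
    by auto
qed

text \<open>Bauer's minimum principle: by Krein--Milman, a minimiser is a convex combination of extreme
  points, and one of these must have an objective value that is no larger.\<close>

lemma concave_minimum_at_extreme_point:
  fixes f :: "'a::euclidean_space \<Rightarrow> real"
  assumes "compact S" and "convex S" and "S \<noteq> {}" and "convex_on UNIV (\<lambda>p. - f p)"
  obtains e where "e extreme_point_of S" and "\<And>q. q \<in> S \<Longrightarrow> f e \<le> f q"
proof -
  have "continuous_on UNIV (\<lambda>p. - (- f p))"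
    using assms(4) by (intro continuous_on_minus convex_on_continuous) auto
  then have "continuous_on S f"
    using continuous_on_subset[of UNIV f S] by simp
  then obtain p where "p \<in> S" and p: "\<And>q. q \<in> S \<Longrightarrow> f p \<le> f q"
    using continuous_attains_inf[OF assms(1,3), of f] by blast
  have "p \<in> convex hull {e. e extreme_point_of S}"
    using Krein_Milman_Minkowski[OF assms(1,2)] \<open>p \<in> S\<close> by simp
  from convex_on_convex_hull_le_generator[OF assms(4) this]
  obtain e where "e extreme_point_of S" "f e \<le> f p"
    by auto
  with p show thesis
    using that order_trans by blast
qed

section \<open>Vertices bound the objective from below\<close>

text \<open>The sets \<open>C\<close> to which this applies are the outer approximations of the epigraph of \<open>g\<close> over \<open>K\<close>.
  The lower bound \<open>m\<close> makes the truncations of \<open>C\<close> compact.\<close>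

lemma vertex_below_epigraph_point:
  fixes g h :: "'a::euclidean_space \<Rightarrow> real"
  assumes "compact K" and "closed C" and "convex C"
    and C_sub: "C \<subseteq> K \<times> {m..}"
    and epi: "epigraph K g \<subseteq> C"
    and g: "continuous_on K g" and h: "convex_on UNIV h" and "z \<in> K"
  obtains v where "v \<in> vert C" and "snd v - h (fst v) \<le> g z - h z"
proof -
  have "bounded (g ` K)"
    using compact_continuous_image[OF g \<open>compact K\<close>] by (rule compact_imp_bounded)
  then obtain B where B: "\<And>w. w \<in> K \<Longrightarrow> \<bar>g w\<bar> \<le> B"
    by (auto simp: bounded_iff)
  define T where "T = B + 1"
  have gT: "g w < T" if "w \<in> K" for w
    using B[OF that] by (simp add: T_def)
  define S where "S = C \<inter> (UNIV \<times> {..T})"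
  have g_in_S: "(w, g w) \<in> S" if "w \<in> K" for w
    using that epi gT[OF that] by (auto simp: S_def epigraph_def)
  have "S = C \<inter> (K \<times> {m..T})"
    using C_sub by (auto simp: S_def)
  then have "compact S"
    using \<open>closed C\<close> \<open>compact K\<close> by (simp add: closed_Int_compact compact_Times)
  moreover have "convex S"
    unfolding S_def using \<open>convex C\<close> by (intro convex_Int convex_Times) auto
  moreover have "S \<noteq> {}"
    using g_in_S \<open>z \<in> K\<close> by auto
  moreover have "convex_on UNIV (\<lambda>p. - (snd p - h (fst p)))"
  proof (rule convex_onI)
    fix t :: real and p q :: "'a \<times> real"
    assume "0 < t" "t < 1"
    then have "h ((1 - t) *\<^sub>R fst p + t *\<^sub>R fst q) \<le> (1 - t) * h (fst p) + t * h (fst q)"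
      using h by (simp add: convex_on_def)
    then show "- (snd ((1 - t) *\<^sub>R p + t *\<^sub>R q) - h (fst ((1 - t) *\<^sub>R p + t *\<^sub>R q)))
      \<le> (1 - t) * - (snd p - h (fst p)) + t * - (snd q - h (fst q))"
      by (simp add: algebra_simps)
  qed simp
  ultimately obtain e where e: "e extreme_point_of S"
    and min: "\<And>q. q \<in> S \<Longrightarrow> snd e - h (fst e) \<le> snd q - h (fst q)"
    using concave_minimum_at_extreme_point[of S "\<lambda>p. snd p - h (fst p)"] by blast
  have "fst e \<in> K"
    using e C_sub by (auto simp: extreme_point_of_def S_def)
  \<comment> \<open>Comparing \<open>e\<close> with the epigraph point with the same first component keeps \<open>e\<close> off the
    artificial facet at height \<open>T\<close>.\<close>
  then have "snd e < T"
    using min[OF g_in_S, of "fst e"] gT[of "fst e"] by simp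
  then have "e \<in> UNIV \<times> {..<T}"
    by (simp add: mem_Times_iff)
  then have "e extreme_point_of C"
    using \<open>convex C\<close> e unfolding S_def
    by (intro extreme_point_of_localize[of C "UNIV \<times> {..<T}" e "UNIV \<times> {..T}"])
      (auto intro: open_Times)
  then show thesis
    using that[of e] min[OF g_in_S[OF \<open>z \<in> K\<close>]] by (simp add: vert_def)
qed

section \<open>The outer approximations\<close>

lemma closed_cut_halfspace: "closed (cut_halfspace g c z)"
  unfolding cut_halfspace_def case_prod_unfold
  by (intro closed_Collect_le continuous_intros)

lemma convex_cut_halfspace: "convex (cut_halfspace g c z)"
proof -
  have "cut_halfspace g c z = {p. (- c z, 1) \<bullet> p \<ge> g z - c z \<bullet> z}"
    by (auto simp: cut_halfspace_def inner_prod_def)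
  then show ?thesis
    by (simp add: convex_halfspace_ge)
qed

text \<open>For a point \<open>(w, g w)\<close> of the graph, membership in the half-space is exactly the subgradient
  inequality at \<open>z\<close>, and raising the second component preserves it.\<close>

lemma epigraph_subset_cut_halfspace:
  assumes "c z \<in> subdifferential g z"
  shows "epigraph K g \<subseteq> cut_halfspace g c z"
proof (clarsimp simp: epigraph_def cut_halfspace_def)
  fix w t
  assume "g w \<le> t"
  moreover have "g z + c z \<bullet> (w - z) \<le> g w"
    using assms by (simp add: subdifferential_def)
  ultimately show "g z - c z \<bullet> z \<le> t - c z \<bullet> w"
    by (simp add: inner_diff_right)
qed

text \<open>Every later outer approximation remains inside the initial one, which is where the lower bound
  on the second component comes from.\<close>

lemma alg3_state_outer_approximation:
  assumes "alg3_state g h c l u \<epsilon> k x G C" and "\<And>z. c z \<in> subdifferential g z"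
  shows "closed C \<and> convex C \<and> epigraph (cbox l u) g \<subseteq> C \<and>
    C \<subseteq> cut_halfspace g c ((1/2) *\<^sub>R (l + u)) \<inter> (cbox l u \<times> UNIV)"
proof -
  have cut: "epigraph (cbox l u) g \<subseteq> cut_halfspace g c z" for z
    using assms(2) by (rule epigraph_subset_cut_halfspace)
  from assms(1) show ?thesis
  proof induction
    case (init x0)
    then show ?case
      using cut
      by (auto intro!: closed_Int closed_Times convex_Int convex_Times
          closed_cut_halfspace convex_cut_halfspace simp: epigraph_def)
  next
    case (iterate k x G C x' y')
    then show ?case
      using cut
      by (auto intro!: closed_Int convex_Int closed_cut_halfspace convex_cut_halfspace)
  qed
qed

lemma cut_halfspace_bounded_below:
  assumes "compact K"
  obtains m where "cut_halfspace g c z \<inter> (K \<times> UNIV) \<subseteq> K \<times> {m..}"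
proof -
  have "bounded ((\<lambda>w. c z \<bullet> w) ` K)"
    by (intro compact_imp_bounded compact_continuous_image continuous_intros assms)
  then obtain B where B: "\<And>w. w \<in> K \<Longrightarrow> \<bar>c z \<bullet> w\<bar> \<le> B"
    by (auto simp: bounded_iff)
  have "g z - c z \<bullet> z - B \<le> t" if "(w, t) \<in> cut_halfspace g c z" "w \<in> K" for w t
    using B[OF that(2)] that(1) by (auto simp: cut_halfspace_def abs_le_iff)
  then show thesis
    using that[of "g z - c z \<bullet> z - B"] by auto
qed

section \<open>Correctness of the stopping criterion\<close>

theorem theorem4p2:
  fixes g h :: "real^'n \<Rightarrow> real" and c :: "real^'n \<Rightarrow> real^'n"
    and l u x :: "real^'n" and \<epsilon> :: real and k :: nat
  assumes "\<And>i. l $ i < u $ i"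
    and "convex_on UNIV g" and "convex_on UNIV h"
    and "\<And>z. c z \<in> subdifferential g z"
    and "\<epsilon> > 0"
    and "alg3_returns g h c l u \<epsilon> k x"
  shows "eps_solution (\<lambda>z. g z - h z) (cbox l u) \<epsilon> x"
proof -
  obtain j x' G C y where state: "alg3_state g h c l u \<epsilon> j x' G C"
    and xy: "(x, y) \<in> argmin_vert h C" and stop: "g x - y \<le> \<epsilon>"
    using assms(6) by (auto simp: alg3_returns_def)
  note C = alg3_state_outer_approximation[OF state assms(4)]
  have cont: "continuous_on (cbox l u) g" "continuous_on (cbox l u) h"
    using convex_on_continuous[OF open_UNIV] assms(2,3) continuous_on_subset by blast+
  have "(x, y) \<in> C"
    using xy by (auto simp: argmin_vert_def is_arg_min_def vert_def extreme_point_of_def)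
  then have x: "x \<in> cbox l u"
    using C by auto
  obtain m where "C \<subseteq> cbox l u \<times> {m..}"
    using cut_halfspace_bounded_below[OF compact_cbox] C by (metis subset_trans)
  then have below: "\<exists>v \<in> vert C. snd v - h (fst v) \<le> g z - h z" if "z \<in> cbox l u" for z
    using vertex_below_epigraph_point[OF compact_cbox _ _ _ _ cont(1) assms(3) that] C by metis
  have vertex_min: "y - h x \<le> snd v - h (fst v)" if "v \<in> vert C" for v
    using xy that by (auto simp: argmin_vert_def is_arg_min_def not_less case_prod_unfold)
  have near: "g x - h x \<le> g z - h z + \<epsilon>" if "z \<in> cbox l u" for z
    using below[OF that] vertex_min stop by force
  obtain z where "z \<in> cbox l u" and "\<And>w. w \<in> cbox l u \<Longrightarrow> g z - h z \<le> g w - h w"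
    using continuous_attains_inf[of "cbox l u" "\<lambda>z. g z - h z"] x cont
    by (auto intro: continuous_on_diff)
  then show ?thesis
    using x near by (auto simp: eps_solution_def is_arg_min_def not_less intro!: exI[of _ z])
qed

end
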